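(* For every finite simple graph $G$, $Z_f^+(G) = \hat{Z}_f^+(G)$.
   Context: All graphs are finite and simple. For a graph $G$ and $r \in \mathbb{N}$, the $r$-blowup $G^{(r)}$ is the graph obtained by replacing each vertex $u$ of $G$ by an independent set $R_u$ of $r$ vertices (called a cluster) and each edge $uw$ of $G$ by all edges between $R_u$ and $R_w$. $r$-fold PSD forcing game: initially a set $B \subseteq V(G^{(r)})$ is colored blue and all other vertices white. At each step, let $B_t$ be the current set of blue vertices and $W_1,\dots,W_h$ the vertex sets of the connected components of $G^{(r)} - B_t$; if $u \in B_t$ and $|N(u) \cap W_i| \le r$ for some $i$, then $u$ may force $N(u)\cap W_i$, i.e. all these vertices are colored blue. $B$ is an $r$-fold PSD forcing set if repeated application of this rule can make all vertices of $G^{(r)}$ blue. $Z_{(r)}^+(G)$ is the minimum cardinality of an $r$-fold PSD forcing set, and $Z_f^+(G) = \inf_{r\in\mathbb{N}} Z_{(r)}^+(G)/r$. Three-color fractional PSD forcing game on $G$: each vertex is initially colored dark blue, light blue, or white; let $\mathcal{D}$ be the set of dark blue and $\mathcal{L}$ the set of light blue vertices. At each step, with $\mathcal{D}_t,\mathcal{L}_t$ the current dark/light blue sets and $W_1,\dots,W_h$ the vertex sets of the connected components of $G-\mathcal{D}_t$: if $u \in \mathcal{D}_t \cup (\mathcal{L}_t\cap W_i)$ and $w\in W_i$ is the only neighbor of $u$ in the induced subgraph $G[\mathcal{D}_t\cup W_i]$ that is light blue or white, then $u$ may force $w$, i.e. $w$ is colored dark blue. $(\mathcal{D},\mathcal{L})$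 is a fractional PSD forcing set if repeated application of this rule can make all vertices dark blue. $\hat{Z}_f^+(G)$ is the minimum of $|\mathcal{D}|$ over all fractional PSD forcing sets $(\mathcal{D},\mathcal{L})$ for $G$. *)

theory Defs
  imports Complex_Main "Graph_Theory.Graph_Theory"
begin

text \<open>
  A finite simple graph is a \<^locale>\<open>pair_graph\<close>: a finite, loop-free, symmetric digraph without
  parallel arcs, so that an undirected edge \<open>uv\<close> is the pair of arcs \<open>(u,v)\<close>, \<open>(v,u)\<close>. The graph
  with no vertices is included.
\<close>

definition nbhd :: "('v, 'e) pre_digraph \<Rightarrow> 'v \<Rightarrow> 'v set" where
  "nbhd H u = {v. u \<rightarrow>\<^bsub>H\<^esub> v}"

text \<open>
  Vertex sets of the connected components of \<open>H - B\<close>. The library provides strongly connected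
  components, which in a symmetric digraph are the connected components.
\<close>
definition comps_minus :: "'v pair_pre_digraph \<Rightarrow> 'v set \<Rightarrow> 'v set set" where
  "comps_minus H B = pre_digraph.sccs_verts (with_proj H \<restriction> (pverts H - B))"


section \<open>The r-fold PSD forcing game\<close>

text \<open>The cluster of \<open>u\<close> is \<open>{u} \<times> {..<r}\<close>.\<close>
definition blowup :: "nat \<Rightarrow> 'a pair_pre_digraph \<Rightarrow> ('a \<times> nat) pair_pre_digraph" where
  "blowup r G = \<lparr> pverts = pverts G \<times> {..<r},
     parcs = {((u, i), (w, j)) | u i w j. (u, w) \<in> parcs G \<and> i < r \<and> j < r} \<rparr>"

lemma pair_graph_blowup:
  assumes "pair_graph G"
  shows "pair_graph (blowup r G)"
proof -
  interpret pair_graph G by fact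
  have sub: "parcs (blowup r G) \<subseteq> (pverts G \<times> {..<r}) \<times> (pverts G \<times> {..<r})"
    by (auto simp: blowup_def dest: in_arcsD1 in_arcsD2)
  have fin: "finite (pverts G \<times> {..<r})"
    using pair_finite_verts by simp
  show ?thesis
  proof unfold_locales
    show "finite (pverts (blowup r G))"
      using fin by (simp add: blowup_def)
    show "finite (parcs (blowup r G))"
      using finite_subset[OF sub] fin by blast
    show "symmetric (with_proj (blowup r G))"
      by (auto simp: symmetric_def sym_def blowup_def intro: arcs_symmetric)
  qed (auto simp: blowup_def dest: in_arcsD1 in_arcsD2 pair_no_loops)
qed

inductive rfold_psd_force :: "nat \<Rightarrow> 'v pair_pre_digraph \<Rightarrow> 'v set \<Rightarrow> 'v set \<Rightarrow> bool"
  for r H where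
  "u \<in> B \<Longrightarrow> W \<in> comps_minus H B \<Longrightarrow> card (nbhd H u \<inter> W) \<le> r
    \<Longrightarrow> rfold_psd_force r H B (B \<union> (nbhd H u \<inter> W))"

definition rfold_psd_forcing_set :: "nat \<Rightarrow> 'a pair_pre_digraph \<Rightarrow> ('a \<times> nat) set \<Rightarrow> bool" where
  "rfold_psd_forcing_set r G B \<longleftrightarrow>
     B \<subseteq> pverts (blowup r G) \<and>
     (rfold_psd_force r (blowup r G))\<^sup>*\<^sup>* B (pverts (blowup r G))"

definition rfold_psd_number :: "nat \<Rightarrow> 'a pair_pre_digraph \<Rightarrow> nat" where
  "rfold_psd_number r G = (LEAST k. \<exists>B. rfold_psd_forcing_set r G B \<and> card B = k)"

definition frac_psd_number :: "'a pair_pre_digraph \<Rightarrow> real" where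
  "frac_psd_number G = (INF r\<in>{1..}. real (rfold_psd_number r G) / real r)"


section \<open>The three-color fractional PSD forcing game\<close>

text \<open>
  The state \<open>(D, L)\<close> consists of the dark blue and the light blue vertices; all others are white.
  Hence \<open>nbhd (G[D \<union> W]) u - D\<close> is the set of neighbors of \<open>u\<close> in \<open>G[D \<union> W]\<close> that are light blue
  or white.
\<close>
inductive frac_psd_force ::
  "'a pair_pre_digraph \<Rightarrow> 'a set \<times> 'a set \<Rightarrow> 'a set \<times> 'a set \<Rightarrow> bool"
  for G where
  "W \<in> comps_minus G D \<Longrightarrow> u \<in> D \<union> (L \<inter> W) \<Longrightarrow> w \<in> W
    \<Longrightarrow> nbhd (with_proj G \<restriction> (D \<union> W)) u - D = {w}
    \<Longrightarrow> frac_psd_force G (D, L) (insert w D, L - {w})"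

definition frac_psd_forcing_set :: "'a pair_pre_digraph \<Rightarrow> 'a set \<times> 'a set \<Rightarrow> bool" where
  "frac_psd_forcing_set G = (\<lambda>(D, L).
     D \<subseteq> pverts G \<and> L \<subseteq> pverts G \<and> D \<inter> L = {} \<and>
     (frac_psd_force G)\<^sup>*\<^sup>* (D, L) (pverts G, {}))"

definition three_color_psd_number :: "'a pair_pre_digraph \<Rightarrow> nat" where
  "three_color_psd_number G = (LEAST k. \<exists>D L. frac_psd_forcing_set G (D, L) \<and> card D = k)"

text \<open>Both minima range over nonempty sets.\<close>

lemma rfold_psd_forcing_set_verts: "rfold_psd_forcing_set r G (pverts (blowup r G))"
  by (simp add: rfold_psd_forcing_set_def)

lemma frac_psd_forcing_set_verts: "frac_psd_forcing_set G (pverts G, {})"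
  by (simp add: frac_psd_forcing_set_def)

end

theory Submission
  imports Defs
begin

text \<open>
  Light blue vertices cost nothing, so in the three-color game every vertex that is not dark blue
  may be taken to be light blue, and one blue vertex in the cluster of each light blue vertex adds
  at most \<open>card (pverts G)\<close> to a blue set of the blowup, which is negligible against \<open>r\<close>. This
  gives \<open>\<le>\<close>. For \<open>\<ge>\<close>, consider the first proper force from a blue set \<open>B\<close> of the blowup. Filling
  all clusters that it meets adds at most \<open>r\<close> vertices. If the filled set corresponds to a dark blue
  set \<open>D'\<close> containing all full clusters, then one of the vertices whose clusters were filled can be
  removed from \<open>D'\<close>, because it is forced in the three-color game; this lowers \<open>r * card D'\<close> by \<open>r\<close>.
\<close>

lemma nbhd_with_proj: "nbhd (with_proj H) u = {v. (u, v) \<in> parcs H}"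
  by (simp add: nbhd_def)

lemma parcs_induce: "arcs_ends (with_proj H \<restriction> S) = parcs H \<inter> S \<times> S"
  by (auto simp: arcs_ends_conv induce_subgraph_def)

section \<open>Components as minimal closed sets\<close>

text \<open>In a symmetric graph, the vertices outside \<open>B\<close> of a vertex set
  \<open>T\<close> with this property form a union of components of \<open>H - B\<close>. Unlike
  being a component, the property survives enlarging \<open>B\<close>, which may split
  components.\<close>

definition closed_off :: "'v pair_pre_digraph \<Rightarrow> 'v set \<Rightarrow> 'v set \<Rightarrow> bool" where
  "closed_off H B T \<longleftrightarrow> (\<forall>x y. x \<in> T - B \<longrightarrow> (x, y) \<in> parcs H \<longrightarrow> y \<in> T \<union> B)"

lemma closed_offD: "closed_off H B T \<Longrightarrow> x \<in> T \<Longrightarrow> x \<notin> B \<Longrightarrow> (x, y) \<in> parcs H \<Longrightarrow> y \<notin> B \<Longrightarrow> y \<in> T"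
  by (auto simp: closed_off_def)

lemma closed_off_mono: "closed_off H B T \<Longrightarrow> B \<subseteq> C \<Longrightarrow> closed_off H C T"
  by (auto simp: closed_off_def)

context pair_graph
begin

lemma wf_minus: "wf_digraph (with_proj G \<restriction> (pverts G - B))"
  by (rule wellformed_induce_subgraph)

lemma comps_minus_subset: "W \<in> comps_minus G B \<Longrightarrow> W \<subseteq> pverts G - B"
  using wf_digraph.sccs_verts_subsets[OF wf_minus] by (fastforce simp: comps_minus_def)

lemma comps_minus_cover:
  assumes "v \<in> pverts G - B"
  obtains W where "W \<in> comps_minus G B" "v \<in> W"
proof
  interpret I: wf_digraph "with_proj G \<restriction> (pverts G - B)" by (rule wf_minus)
  show "I.scc_of v \<in> comps_minus G B"
    unfolding comps_minus_def using assms by (intro I.scc_of_in_sccs_verts) simp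
  show "v \<in> I.scc_of v"
    using assms by (intro I.in_scc_of_self) simp
qed

text \<open>Symmetry is what matters: an arc between two vertices outside \<open>B\<close> comes
  with its reverse, so its ends are mutually reachable and share a component.\<close>

lemma comps_minus_closed:
  assumes "W \<in> comps_minus G B"
  shows "closed_off G B W"
  unfolding closed_off_def
proof (intro allI impI)
  fix x y assume x: "x \<in> W - B" and xy: "(x, y) \<in> parcs G"
  interpret I: wf_digraph "with_proj G \<restriction> (pverts G - B)" by (rule wf_minus)
  show "y \<in> W \<union> B"
  proof (rule ccontr)
    assume y: "y \<notin> W \<union> B"
    have "x \<in> pverts G" "y \<in> pverts G" "(y, x) \<in> parcs G"
      using xy by (auto dest: wellformed' arcs_symmetric)
    then have "x \<rightarrow>\<^sup>*\<^bsub>with_proj G \<restriction> (pverts G - B)\<^esub> y" "y \<rightarrow>\<^sup>*\<^bsub>with_proj G \<restriction> (pverts G - B)\<^esub> x"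
      using x y xy by (auto intro!: I.reachable_adjI simp: parcs_induce)
    then show False
      using assms x y by (auto simp: comps_minus_def I.in_sccs_verts_conv_reachable)
  qed
qed

text \<open>Every vertex of \<open>W\<close> is reached from \<open>v\<close> by a walk avoiding
  \<open>B\<close>, and such a walk cannot leave \<open>T\<close>.\<close>

lemma comps_minus_least:
  assumes W: "W \<in> comps_minus G B" and v: "v \<in> W" "v \<in> T" and T: "closed_off G B T"
  shows "W \<subseteq> T"
proof
  fix w assume "w \<in> W"
  interpret I: wf_digraph "with_proj G \<restriction> (pverts G - B)" by (rule wf_minus)
  have "v \<rightarrow>\<^sup>*\<^bsub>with_proj G \<restriction> (pverts G - B)\<^esub> w"
    using W v \<open>w \<in> W\<close> by (auto simp: comps_minus_def I.in_sccs_verts_conv_reachable)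
  then show "w \<in> T"
    using v(2) by (induction rule: I.reachable_induct) (use T in \<open>auto simp: parcs_induce dest: closed_offD\<close>)
qed

section \<open>The r-fold game\<close>

text \<open>The vertex \<open>u\<close> forces into the components inside \<open>T\<close> one after
  another. Each portion is part of \<open>nbhd G u \<inter> T\<close>, so the bound \<open>r\<close>
  on the whole set covers every single force, and \<open>T\<close> stays closed as the blue set
  grows.\<close>

lemma rfold_force_closed:
  assumes "u \<in> B" "closed_off G B T" "card (nbhd G u \<inter> T) \<le> r"
  shows "(rfold_psd_force r G)\<^sup>*\<^sup>* B (B \<union> (nbhd G u \<inter> T))"
proof -
  have fin: "finite (nbhd G u)"
    by (rule finite_subset[OF _ pair_finite_verts]) (auto simp: nbhd_with_proj dest: wellformed')
  show ?thesis
    using assms(1,2)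
  proof (induction "card (nbhd G u \<inter> T - B)" arbitrary: B rule: less_induct)
    case (less B)
    show ?case
    proof (cases "nbhd G u \<inter> T \<subseteq> B")
      case True
      then show ?thesis by (simp add: Un_absorb2)
    next
      case False
      then obtain v where v: "v \<in> nbhd G u" "v \<in> T" "v \<notin> B" by auto
      moreover from v have "v \<in> pverts G" by (auto simp: nbhd_with_proj dest: wellformed')
      ultimately obtain W where W: "W \<in> comps_minus G B" "v \<in> W"
        using comps_minus_cover[of v B] by auto
      have WT: "W \<subseteq> T" using comps_minus_least W v less.prems by blast
      define C where "C = B \<union> (nbhd G u \<inter> W)"
      have "card (nbhd G u \<inter> W) \<le> card (nbhd G u \<inter> T)"
        using WT fin by (intro card_mono) auto
      then have step: "rfold_psd_force r G B C"
        unfolding C_def using less.prems W assms(3) by (intro rfold_psd_force.intros) auto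
      have "card (nbhd G u \<inter> T - C) < card (nbhd G u \<inter> T - B)"
        by (rule psubset_card_mono) (use fin v W in \<open>auto simp: C_def\<close>)
      moreover have "closed_off G C T" "u \<in> C"
        using less.prems by (auto simp: C_def elim: closed_off_mono)
      ultimately have "(rfold_psd_force r G)\<^sup>*\<^sup>* C (C \<union> (nbhd G u \<inter> T))"
        by (intro less.hyps) auto
      moreover have "C \<union> (nbhd G u \<inter> T) = B \<union> (nbhd G u \<inter> T)"
        using WT by (auto simp: C_def)
      ultimately show ?thesis
        using step by (metis converse_rtranclp_into_rtranclp)
    qed
  qed
qed

text \<open>With more blue vertices a component may split, but it is still closed, so each original
  force can be replayed as a sequence of forces.\<close>

lemma rfold_force_mono:
  assumes "(rfold_psd_force r G)\<^sup>*\<^sup>* B (pverts G)" "B \<subseteq> C" "C \<subseteq> pverts G"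
  shows "(rfold_psd_force r G)\<^sup>*\<^sup>* C (pverts G)"
  using assms
proof (induction arbitrary: C rule: converse_rtranclp_induct)
  case base
  then show ?case by auto
next
  case (step B B')
  from step.hyps(1) obtain u W where *: "B' = B \<union> (nbhd G u \<inter> W)" "u \<in> B"
      "W \<in> comps_minus G B" "card (nbhd G u \<inter> W) \<le> r"
    by (cases rule: rfold_psd_force.cases) auto
  then have "(rfold_psd_force r G)\<^sup>*\<^sup>* C (C \<union> (nbhd G u \<inter> W))"
    using step.prems closed_off_mono[OF comps_minus_closed]
    by (intro rfold_force_closed) auto
  moreover have "(rfold_psd_force r G)\<^sup>*\<^sup>* (C \<union> (nbhd G u \<inter> W)) (pverts G)"
    using * step.prems comps_minus_subset[OF *(3)] by (intro step.IH) auto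
  ultimately show ?case by simp
qed

section \<open>From the three-color game to the r-fold game\<close>

text \<open>Clusters of dark blue vertices are kept full and those of light blue vertices keep index
  0 blue. A force of \<open>w\<close> by \<open>u\<close> then becomes a force of the whole cluster
  of \<open>w\<close> by \<open>(u, 0)\<close>.\<close>

lemma frac_force_imp_rfold_force:
  assumes r: "0 < r" and "(frac_psd_force G)\<^sup>*\<^sup>* (D, L) (pverts G, {})"
    and "D \<times> {..<r} \<union> L \<times> {0} \<subseteq> B" "B \<subseteq> pverts (blowup r G)"
  shows "(rfold_psd_force r (blowup r G))\<^sup>*\<^sup>* B (pverts (blowup r G))"
proof -
  interpret H: pair_graph "blowup r G" by (rule pair_graph_blowup) unfold_locales
  have "\<forall>B. fst s \<times> {..<r} \<union> snd s \<times> {0} \<subseteq> B \<longrightarrow> B \<subseteq> pverts (blowup r G) \<longrightarrow>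
      (rfold_psd_force r (blowup r G))\<^sup>*\<^sup>* B (pverts (blowup r G))"
    if "(frac_psd_force G)\<^sup>*\<^sup>* s (pverts G, {})" for s
    using that
  proof (induction rule: converse_rtranclp_induct)
    case base
    then show ?case by (auto simp: blowup_def)
  next
    case (step s s')
    from step.hyps(1) obtain D L W u w where s: "s = (D, L)" "s' = (insert w D, L - {w})"
      and W: "W \<in> comps_minus G D" and u: "u \<in> D \<union> (L \<inter> W)" and w: "w \<in> W"
      and uw: "nbhd (with_proj G \<restriction> (D \<union> W)) u - D = {w}"
      by (cases rule: frac_psd_force.cases) auto
    show ?case
    proof (intro allI impI)
      fix B assume B: "fst s \<times> {..<r} \<union> snd s \<times> {0} \<subseteq> B" "B \<subseteq> pverts (blowup r G)"
      \<comment> \<open>As \<open>W\<close> avoids \<open>D\<close>, the only neighbor of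
        \<open>u\<close> in \<open>W\<close> is \<open>w\<close>; hence exactly \<open>r\<close>
        vertices are to be forced.\<close>
      have *: "nbhd (blowup r G) (u, 0) \<inter> W \<times> {..<r} = {w} \<times> {..<r}"
        using uw w r u comps_minus_subset[OF W]
        by (auto simp: nbhd_def parcs_induce blowup_def)
      \<comment> \<open>Arcs leaving \<open>W\<close> end in \<open>D\<close>, whose clusters are
        entirely blue.\<close>
      have cl: "closed_off (blowup r G) B (W \<times> {..<r})"
        using comps_minus_closed[OF W] B comps_minus_subset[OF W]
        by (fastforce simp: closed_off_def blowup_def s)
      have "(u, 0) \<in> B" using u B r by (auto simp: s)
      then have "(rfold_psd_force r (blowup r G))\<^sup>*\<^sup>* B (B \<union> (nbhd (blowup r G) (u, 0) \<inter> W \<times> {..<r}))"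
        by (intro H.rfold_force_closed cl) (simp_all add: * card_cartesian_product)
      moreover have "(rfold_psd_force r (blowup r G))\<^sup>*\<^sup>* (B \<union> {w} \<times> {..<r}) (pverts (blowup r G))"
        using B w comps_minus_subset[OF W]
        by (intro step.IH[rule_format]) (auto simp: s blowup_def)
      ultimately show "(rfold_psd_force r (blowup r G))\<^sup>*\<^sup>* B (pverts (blowup r G))"
        by (simp add: *)
    qed
  qed
  then show ?thesis using assms by fastforce
qed

lemma rfold_psd_number_le:
  assumes "0 < r" "frac_psd_forcing_set G (D, L)"
  shows "rfold_psd_number r G \<le> r * card D + card (pverts G)"
proof -
  let ?B = "D \<times> {..<r} \<union> L \<times> {0}"
  have DL: "D \<subseteq> pverts G" "L \<subseteq> pverts G" "(frac_psd_force G)\<^sup>*\<^sup>* (D, L) (pverts G, {})"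
    using assms(2) by (auto simp: frac_psd_forcing_set_def)
  then have sub: "?B \<subseteq> pverts (blowup r G)" using assms(1) by (auto simp: blowup_def)
  have "rfold_psd_forcing_set r G ?B"
    unfolding rfold_psd_forcing_set_def
    using frac_force_imp_rfold_force[OF assms(1) DL(3) order_refl sub] sub by simp
  then have "rfold_psd_number r G \<le> card ?B"
    unfolding rfold_psd_number_def by (intro Least_le) auto
  also have "\<dots> \<le> card (D \<times> {..<r}) + card (L \<times> {0::nat})" by (rule card_Un_le)
  also have "\<dots> \<le> r * card D + card (pverts G)"
    using card_mono[OF pair_finite_verts DL(2)] by (simp add: card_cartesian_product mult.commute)
  finally show ?thesis .
qed

section \<open>From the r-fold game to the three-color game\<close>

text \<open>The clause on full clusters strengthens the induction: a vertex outside \<open>D\<close>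
  has a white vertex in its cluster, so walks of \<open>G - D\<close> lift to white walks of the
  blowup.\<close>

lemma rfold_force_imp_frac_force:
  assumes r: "0 < r" and "(rfold_psd_force r (blowup r G))\<^sup>*\<^sup>* B (pverts (blowup r G))"
    and "B \<subseteq> pverts (blowup r G)"
  shows "\<exists>D \<subseteq> pverts G. (\<forall>x \<in> pverts G. {x} \<times> {..<r} \<subseteq> B \<longrightarrow> x \<in> D) \<and>
    (frac_psd_force G)\<^sup>*\<^sup>* (D, pverts G - D) (pverts G, {}) \<and> r * card D \<le> card B"
  using assms(2,3)
proof (induction "card (pverts (blowup r G) - B)" arbitrary: B rule: less_induct)
  case (less B)
  let ?H = "blowup r G"
  interpret H: pair_graph ?H by (rule pair_graph_blowup) unfold_locales
  show ?case
  proof (cases "B = pverts ?H")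
    case True
    then show ?thesis
      by (intro exI[of _ "pverts G"]) (auto simp: blowup_def card_cartesian_product)
  next
    case False
    \<comment> \<open>Forces that color nothing are allowed and are skipped here.\<close>
    have "\<exists>B'. rfold_psd_force r ?H B B' \<and> B' \<noteq> B"
      using less.prems(1) False by (induction rule: converse_rtranclp_induct) auto
    then obtain u W where u: "u \<in> B" and W: "W \<in> comps_minus ?H B"
      and card: "card (nbhd ?H u \<inter> W) \<le> r" and ne: "nbhd ?H u \<inter> W \<noteq> {}"
      by (auto elim!: rfold_psd_force.cases)
    obtain a k where a: "u = (a, k)" by force
    define S where "S = nbhd ?H u \<inter> W"
    define C where "C = B \<union> fst ` S \<times> {..<r}"
    note Wsub = H.comps_minus_subset[OF W] and Wcl = H.comps_minus_closed[OF W]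
    have finB: "finite B" using less.prems(2) H.pair_finite_verts finite_subset by blast
    have finS: "finite S"
      unfolding S_def by (intro finite_subset[OF _ H.pair_finite_verts]) (use Wsub in auto)
    have Csub: "C \<subseteq> pverts ?H"
      using less.prems(2) Wsub by (auto simp: C_def S_def blowup_def)
    have SB: "S \<inter> B = {}" "S \<subseteq> C" using Wsub by (auto simp: S_def C_def blowup_def image_iff Bex_def)
    \<comment> \<open>Filling clusters could seem to cost \<open>r * card S\<close>. But either all
      their white vertices lie in \<open>S\<close>, which has at most \<open>r\<close> elements, or
      only a single cluster is met.\<close>
    have cardC: "card C \<le> card B + r"
    proof (cases "fst ` S \<times> {..<r} - B \<subseteq> S")
      case True
      then have "card C \<le> card (B \<union> S)"
        unfolding C_def using finB finS by (intro card_mono) auto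
      also have "\<dots> \<le> card B + r"
        using card_Un_le[of B S] card by (simp add: S_def)
      finally show ?thesis .
    next
      case False
      txt \<open>A white twin outside \<open>W\<close> of a vertex of \<open>W\<close> shares its neighbors, so these are all blue
        and \<open>W\<close> is a single vertex.\<close>
      then obtain y i j where y: "(y, i) \<in> S" "j < r" "(y, j) \<notin> B" "(y, j) \<notin> S" by fastforce
      have yW: "(y, i) \<in> W" "(y, j) \<notin> W" using y by (auto simp: S_def nbhd_def blowup_def a)
      have "closed_off ?H B {(y, i)}"
        unfolding closed_off_def
      proof (intro allI impI)
        fix p q assume p: "p \<in> {(y, i)} - B" and pq: "(p, q) \<in> parcs ?H"
        show "q \<in> {(y, i)} \<union> B"
        proof (rule ccontr)
          assume q: "q \<notin> {(y, i)} \<union> B"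
          then have "q \<in> W" using closed_offD[OF Wcl yW(1), of q] p pq by blast
          moreover have "(q, (y, j)) \<in> parcs ?H"
            using p pq y(2) by (auto simp: blowup_def dest: arcs_symmetric)
          ultimately show False using closed_offD[OF Wcl] q y yW by auto
        qed
      qed
      then have "W = {(y, i)}" using H.comps_minus_least[OF W yW(1)] yW by blast
      then have "fst ` S \<times> {..<r} = {y} \<times> {..<r}" using y(1) by (auto simp: S_def)
      then show ?thesis
        using card_Un_le[of B "{y} \<times> {..<r}"] by (simp add: C_def card_cartesian_product)
    qed
    obtain w i where w: "(w, i) \<in> S" using ne by (auto simp: S_def)
    have "B \<subseteq> C" by (simp add: C_def)
    moreover have "(w, i) \<in> pverts ?H" "(w, i) \<in> C" "(w, i) \<notin> B" using w SB Csub by blast+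
    ultimately have "pverts ?H - C \<subset> pverts ?H - B" by blast
    then have "card (pverts ?H - C) < card (pverts ?H - B)"
      by (intro psubset_card_mono) (simp_all add: H.pair_finite_verts)
    moreover have "(rfold_psd_force r ?H)\<^sup>*\<^sup>* C (pverts ?H)"
      by (rule H.rfold_force_mono[OF less.prems(1) _ Csub]) (auto simp: C_def)
    ultimately obtain D' where D': "D' \<subseteq> pverts G" "\<And>x. x \<in> pverts G \<Longrightarrow> {x} \<times> {..<r} \<subseteq> C \<Longrightarrow> x \<in> D'"
        "(frac_psd_force G)\<^sup>*\<^sup>* (D', pverts G - D') (pverts G, {})" "r * card D' \<le> card C"
      using less.hyps Csub by meson
    have SD': "fst p \<in> D'" if "p \<in> S" for p
      using that Wsub by (intro D'(2)) (auto simp: C_def S_def blowup_def)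
    define D where "D = D' - {w}"
    have wD: "w \<in> D'" "w \<notin> D" "w \<in> pverts G" "D \<subseteq> pverts G" using SD'[OF w] D'(1) by (auto simp: D_def)
    \<comment> \<open>The clause on full clusters survives the removal of \<open>w\<close>, since
      \<open>(w, i)\<close> is white in \<open>B\<close>.\<close>
    have fullD: "x \<in> D" if "x \<in> pverts G" "{x} \<times> {..<r} \<subseteq> B" for x
    proof -
      have "(w, i) \<in> pverts ?H" "(w, i) \<notin> B" using w SB Csub by blast+
      then have "x \<noteq> w" using that(2) by (auto simp: blowup_def)
      moreover have "x \<in> D'" using that by (intro D'(2)) (auto simp: C_def)
      ultimately show ?thesis by (simp add: D_def)
    qed
    obtain W' where W': "W' \<in> comps_minus G D" "w \<in> W'"
      using comps_minus_cover[of w D] wD by auto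
    have aw: "(a, w) \<in> parcs G" using w by (auto simp: S_def a nbhd_def blowup_def)
    then have aw': "(w, a) \<in> parcs G" "a \<in> pverts G" by (auto dest: arcs_symmetric wellformed')
    \<comment> \<open>A neighbor \<open>y\<close> outside \<open>D\<close> of some \<open>x\<close>
      in the projection has a white copy, which is adjacent to every copy of \<open>x\<close> and
      therefore lies in \<open>W\<close>.\<close>
    have "closed_off G D (fst ` W)"
      unfolding closed_off_def
    proof (intro allI impI)
      fix x y assume x: "x \<in> fst ` W - D" and xy: "(x, y) \<in> parcs G"
      show "y \<in> fst ` W \<union> D"
      proof (rule ccontr)
        assume y: "y \<notin> fst ` W \<union> D"
        have "y \<in> pverts G" using xy by (auto dest: wellformed')
        then obtain j where j: "j < r" "(y, j) \<notin> B" using fullD[of y] y by auto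
        obtain i where i: "(x, i) \<in> W" using x by auto
        then have "((x, i), (y, j)) \<in> parcs ?H" using xy j Wsub by (auto simp: blowup_def)
        then have "(y, j) \<in> W" using closed_offD[OF Wcl i, of "(y, j)"] Wsub i j by blast
        then have "y \<in> fst ` W" by (rule rev_image_eqI) simp
        then show False using y by blast
      qed
    qed
    moreover have "w \<in> fst ` W" using w by (auto simp: S_def intro: rev_image_eqI)
    ultimately have W'W: "W' \<subseteq> fst ` W"
      using comps_minus_least[OF W'(1,2)] by blast
    \<comment> \<open>Being adjacent to \<open>w\<close>, the vertex \<open>a\<close> is dark blue
      or lies in \<open>W'\<close>; in the latter case it is light blue, like everything outside
      \<open>D\<close>. Either way it is entitled to force in \<open>W'\<close>.\<close>
    have aDW: "a \<in> D \<union> W'"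
      using closed_offD[OF comps_minus_closed[OF W'(1)] W'(2) wD(2) aw'(1)] by blast
    \<comment> \<open>Neighbors of \<open>a\<close> in \<open>W'\<close> are projections of vertices
      of \<open>S\<close>; their clusters are full in \<open>C\<close>, so they lie in
      \<open>D'\<close>, and only \<open>w\<close> was removed from it.\<close>
    have "x = w" if x: "x \<in> W'" "(a, x) \<in> parcs G" "x \<notin> D" for x
    proof -
      from x(1) W'W obtain i where i: "(x, i) \<in> W" by auto
      have "(x, i) \<in> pverts ?H" "(a, k) \<in> pverts ?H" using i Wsub u less.prems(2) a by blast+
      then have "(x, i) \<in> S" using x(2) i by (simp add: S_def nbhd_def blowup_def a)
      then show ?thesis using SD'[of "(x, i)"] x(3) by (simp add: D_def)
    qed
    then have "nbhd (with_proj G \<restriction> (D \<union> W')) a - D = {w}"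
      using aw aDW W'(2) wD(2) unfolding nbhd_def parcs_induce by blast
    then have "frac_psd_force G (D, pverts G - D) (insert w D, (pverts G - D) - {w})"
      using W' aDW aw'(2) by (intro frac_psd_force.intros[of W']) auto
    moreover have "insert w D = D'" "(pverts G - D) - {w} = pverts G - D'"
      using wD(1) by (auto simp: D_def)
    ultimately have "frac_psd_force G (D, pverts G - D) (D', pverts G - D')" by simp
    then have "(frac_psd_force G)\<^sup>*\<^sup>* (D, pverts G - D) (pverts G, {})"
      using D'(3) by (rule converse_rtranclp_into_rtranclp)
    moreover have "r * card D \<le> card B"
    proof -
      have "card D' = Suc (card D)"
        unfolding D_def by (rule card.remove[OF finite_subset[OF D'(1) pair_finite_verts] wD(1)])
      then show ?thesis using D'(4) cardC by simp
    qed
    ultimately show ?thesis using wD(4) fullD by (intro exI[of _ D]) simp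
  qed
qed

lemma three_color_psd_number_le:
  assumes "0 < r" "rfold_psd_forcing_set r G B"
  shows "r * three_color_psd_number G \<le> card B"
proof -
  obtain D where D: "D \<subseteq> pverts G" "(frac_psd_force G)\<^sup>*\<^sup>* (D, pverts G - D) (pverts G, {})"
      "r * card D \<le> card B"
    using rfold_force_imp_frac_force[OF assms(1), of B] assms(2)
    unfolding rfold_psd_forcing_set_def by blast
  then have "three_color_psd_number G \<le> card D"
    unfolding three_color_psd_number_def
    by (intro Least_le exI[of _ D] exI[of _ "pverts G - D"]) (auto simp: frac_psd_forcing_set_def)
  then show ?thesis using D(3) by (meson le_trans mult_le_mono2)
qed

end

theorem theorem2p19:
  fixes G :: "'a pair_pre_digraph"
  assumes "pair_graph G"
  shows "frac_psd_number G = real (three_color_psd_number G)"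
proof -
  interpret pair_graph G by fact
  let ?z = "three_color_psd_number G" and ?f = "\<lambda>r. real (rfold_psd_number r G) / real r"
  have "\<exists>D L. frac_psd_forcing_set G (D, L) \<and> card D = ?z"
    unfolding three_color_psd_number_def
    by (rule LeastI_ex) (use frac_psd_forcing_set_verts in blast)
  then obtain D L where DL: "frac_psd_forcing_set G (D, L)" "card D = ?z" by blast
  have lower: "?z \<le> ?f r" if "r \<in> {1..}" for r
  proof -
    have "\<exists>B. rfold_psd_forcing_set r G B \<and> card B = rfold_psd_number r G"
      unfolding rfold_psd_number_def
      by (rule LeastI_ex) (use rfold_psd_forcing_set_verts in blast)
    then have "r * ?z \<le> rfold_psd_number r G"
      using three_color_psd_number_le[of r] that by (metis atLeast_iff less_eq_Suc_le One_nat_def)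
    then have "real r * real ?z \<le> real (rfold_psd_number r G)"
      by (metis of_nat_le_iff of_nat_mult)
    then show ?thesis using that by (simp add: field_simps)
  qed
  \<comment> \<open>One optimal pair \<open>(D, L)\<close> is used for all \<open>r\<close>. The
    additive error \<open>card (pverts G)\<close> from the light blue vertices, divided by
    \<open>r\<close>, drops below \<open>e\<close> once \<open>r\<close> is large.\<close>
  have "frac_psd_number G \<le> ?z + e" if e: "e > 0" for e :: real
  proof -
    obtain r where r: "real (card (pverts G)) / e < real r" "0 < r"
      using reals_Archimedean2[of "real (card (pverts G)) / e"] e
      by (metis divide_nonneg_pos gr0I not_less of_nat_0 of_nat_0_le_iff)
    have "real (rfold_psd_number r G) \<le> real r * ?z + card (pverts G)"
      using rfold_psd_number_le[OF r(2) DL(1)] DL(2) by (metis of_nat_le_iff of_nat_mult of_nat_add)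
    also have "\<dots> \<le> (?z + e) * r" using r(1) e by (simp add: field_simps)
    finally have "?f r \<le> ?z + e" using r(2) by (simp add: field_simps)
    moreover have "frac_psd_number G \<le> ?f r"
      unfolding frac_psd_number_def using r(2) by (intro cINF_lower bdd_belowI2[of _ 0]) auto
    ultimately show ?thesis by simp
  qed
  then have "frac_psd_number G \<le> ?z" by (rule field_le_epsilon)
  moreover have "?z \<le> frac_psd_number G"
    unfolding frac_psd_number_def by (rule cINF_greatest) (use lower in auto)
  ultimately show ?thesis by simp
qed

end
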